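(* Let $R$ be a commutative ring with $w\text{-}\dim(R)=0$. Then $\dim(R)=0$, and so $R$ is a DW ring.
   Context: All rings are commutative with identity, and $\dim(R)$ denotes the Krull dimension of $R$. A finitely generated ideal $J$ of $R$ is a GV-ideal if the natural homomorphism $R\to \mathrm{Hom}_R(J,R)$, $r\mapsto (a\mapsto ra)$, is an isomorphism (equivalently, $\mathrm{Hom}_R(R/J,R)=0=\mathrm{Ext}^1_R(R/J,R)$). For an ideal $I$ of $R$, put $I_w=\{x\in R\mid Jx\subseteq I\text{ for some GV-ideal } J \text{ of } R\}$; $I$ is a $w$-ideal if $I_w=I$. A maximal $w$-ideal is an ideal maximal among the proper $w$-ideals of $R$; maximal $w$-ideals are prime. The $w$-Krull dimension $w\text{-}\dim(R)$ is the supremum of the heights of all maximal $w$-ideals of $R$. A DW ring is a ring in which every ideal is a $w$-ideal. *)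

theory Defs
  imports "HOL-Algebra.Algebra" "HOL-Library.Extended_Real"
begin

definition fg_ideal :: "('a, 'm) ring_scheme \<Rightarrow> 'a set \<Rightarrow> bool" where
  "fg_ideal R J \<longleftrightarrow> (\<exists>A. finite A \<and> A \<subseteq> carrier R \<and> J = Idl\<^bsub>R\<^esub> A)"

text \<open>
  The underlying set of \<open>Hom\<^sub>R(J, R)\<close> for an ideal \<open>J\<close>; homomorphisms are extensional functions
  (\<^const>\<open>undefined\<close> outside \<open>J\<close>), so that HOL equality is equality of maps on \<open>J\<close>.
\<close>
definition Hom_to_ring :: "('a, 'm) ring_scheme \<Rightarrow> 'a set \<Rightarrow> ('a \<Rightarrow> 'a) set" where
  "Hom_to_ring R J =
     {f \<in> J \<rightarrow>\<^sub>E carrier R.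
        (\<forall>a\<in>J. \<forall>b\<in>J. f (a \<oplus>\<^bsub>R\<^esub> b) = f a \<oplus>\<^bsub>R\<^esub> f b) \<and>
        (\<forall>r\<in>carrier R. \<forall>a\<in>J. f (r \<otimes>\<^bsub>R\<^esub> a) = r \<otimes>\<^bsub>R\<^esub> f a)}"

definition homothety :: "('a, 'm) ring_scheme \<Rightarrow> 'a set \<Rightarrow> 'a \<Rightarrow> 'a \<Rightarrow> 'a" where
  "homothety R J r = (\<lambda>a\<in>J. r \<otimes>\<^bsub>R\<^esub> a)"

text \<open>
  The natural map \<open>R \<rightarrow> Hom\<^sub>R(J, R)\<close> always lands in \<open>Hom\<^sub>R(J, R)\<close> and is linear for the
  pointwise operations, so it is an isomorphism of modules iff it is bijective.
\<close>

lemma (in cring) homothety_in_Hom: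
  assumes "ideal J R" "r \<in> carrier R"
  shows "homothety R J r \<in> Hom_to_ring R J"
proof -
  interpret J: ideal J R by fact
  show ?thesis
    using assms(2) J.a_Hcarr J.I_l_closed J.a_closed
    by (auto simp: homothety_def Hom_to_ring_def r_distr m_lcomm)
qed

lemma (in cring) homothety_linear:
  assumes "ideal J R" "r \<in> carrier R" "s \<in> carrier R" "a \<in> J"
  shows "homothety R J (r \<oplus> s) a = homothety R J r a \<oplus> homothety R J s a"
    and "homothety R J (s \<otimes> r) a = s \<otimes> homothety R J r a"
proof -
  have "a \<in> carrier R"
    using assms ideal.axioms(1) additive_subgroup.a_Hcarr by metis
  then show "homothety R J (r \<oplus> s) a = homothety R J r a \<oplus> homothety R J s a"
    "homothety R J (s \<otimes> r) a = s \<otimes> homothety R J r a"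
    using assms by (auto simp: homothety_def l_distr m_assoc)
qed

definition GV_ideal :: "('a, 'm) ring_scheme \<Rightarrow> 'a set \<Rightarrow> bool" where
  "GV_ideal R J \<longleftrightarrow>
     fg_ideal R J \<and> bij_betw (homothety R J) (carrier R) (Hom_to_ring R J)"

definition w_closure :: "('a, 'm) ring_scheme \<Rightarrow> 'a set \<Rightarrow> 'a set" where
  "w_closure R I =
     {x \<in> carrier R. \<exists>J. GV_ideal R J \<and> (\<forall>a\<in>J. a \<otimes>\<^bsub>R\<^esub> x \<in> I)}"

definition w_ideal :: "('a, 'm) ring_scheme \<Rightarrow> 'a set \<Rightarrow> bool" where
  "w_ideal R I \<longleftrightarrow> ideal I R \<and> w_closure R I = I"

definition maximal_w_ideal :: "('a, 'm) ring_scheme \<Rightarrow> 'a set \<Rightarrow> bool" where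
  "maximal_w_ideal R M \<longleftrightarrow>
     w_ideal R M \<and> M \<noteq> carrier R \<and>
     (\<forall>N. w_ideal R N \<longrightarrow> N \<noteq> carrier R \<longrightarrow> M \<subseteq> N \<longrightarrow> N = M)"

definition prime_chain :: "('a, 'm) ring_scheme \<Rightarrow> nat \<Rightarrow> (nat \<Rightarrow> 'a set) \<Rightarrow> bool" where
  "prime_chain R n P \<longleftrightarrow>
     (\<forall>i\<le>n. primeideal (P i) R) \<and> (\<forall>i<n. P i \<subset> P (Suc i))"

text \<open>
  Dimensions take values in \<^typ>\<open>ereal\<close>, where the supremum of the empty set is \<open>-\<infinity>\<close>;
  in particular both dimensions of the zero ring are \<open>-\<infinity>\<close>, not \<open>0\<close>.
  The height is meant for prime ideals only.
\<close>
definition prime_height :: "('a, 'm) ring_scheme \<Rightarrow> 'a set \<Rightarrow> ereal" where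
  "prime_height R Q = Sup {ereal (real n) | n. \<exists>P. prime_chain R n P \<and> P n = Q}"

definition krull_dim :: "('a, 'm) ring_scheme \<Rightarrow> ereal" where
  "krull_dim R = Sup {ereal (real n) | n. \<exists>P. prime_chain R n P}"

definition w_krull_dim :: "('a, 'm) ring_scheme \<Rightarrow> ereal" where
  "w_krull_dim R = Sup {prime_height R M | M. maximal_w_ideal R M}"

definition DW_ring :: "('a, 'm) ring_scheme \<Rightarrow> bool" where
  "DW_ring R \<longleftrightarrow> (\<forall>I. ideal I R \<longrightarrow> w_ideal R I)"

end

theory Submission
  imports Defs
begin

text \<open>
  Zorn's lemma yields prime \<open>w\<close>-ideals that are maximal among the ideals containing no
  GV-ideal; by hypothesis these are minimal primes. An element \<open>a\<close> of a minimal prime \<open>P\<close> satisfies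
  \<open>s a\<^sup>n = 0\<close> for some \<open>s \<notin> P\<close>, so the ideal \<open>Ra + {s. \<exists>n. s a\<^sup>n = 0}\<close> lies in none of
  them and contains a GV-ideal, and then so does \<open>Ra\<^sup>n\<^sup>+\<^sup>1 + ann(a\<^sup>n)\<close> for some \<open>n\<close>. The
  homomorphism \<open>r a\<^sup>n\<^sup>+\<^sup>1 + s \<mapsto> r a\<^sup>n\<close> on that ideal is therefore multiplication by an element
  \<open>c\<close>, which gives \<open>c a\<^sup>n\<^sup>+\<^sup>1 = a\<^sup>n\<close>. Hence \<open>R\<close> is strongly \<open>\<pi>\<close>-regular, so it has dimension
  \<open>0\<close>; moreover every finitely generated proper ideal has a nonzero annihilator, so \<open>R\<close> is its only
  GV-ideal.
\<close>

section \<open>Ideals, and sums of a principal ideal with a given ideal\<close>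

lemma (in cring) cring_idealI:
  assumes "I \<subseteq> carrier R" "\<zero> \<in> I"
    and add: "\<And>x y. x \<in> I \<Longrightarrow> y \<in> I \<Longrightarrow> x \<oplus> y \<in> I"
    and mult: "\<And>r x. r \<in> carrier R \<Longrightarrow> x \<in> I \<Longrightarrow> r \<otimes> x \<in> I"
  shows "ideal I R"
proof (rule idealI[OF ring_axioms])
  have inv: "\<ominus> x \<in> I" if "x \<in> I" for x
  proof -
    have "x \<in> carrier R" using that assms(1) by auto
    then have "\<ominus> x = (\<ominus> \<one>) \<otimes> x" by (simp add: l_minus)
    then show ?thesis using mult[of "\<ominus> \<one>" x] that by simp
  qed
  show "subgroup I (add_monoid R)"
    by (rule add.subgroupI) (use assms inv in \<open>auto simp: a_inv_def\<close>)
  show "x \<otimes> a \<in> I" if "a \<in> I" "x \<in> carrier R" for a x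
    using that mult by auto
  show "a \<otimes> x \<in> I" if "a \<in> I" "x \<in> carrier R" for a x
    using that mult[of x a] assms(1) by (metis m_comm subsetD)
qed

lemma (in cring) mem_cgenideal_plus:
  "y \<in> PIdl x <+>\<^bsub>R\<^esub> P \<longleftrightarrow> (\<exists>r\<in>carrier R. \<exists>p\<in>P. y = r \<otimes> x \<oplus> p)"
  by (auto simp: set_add_def' cgenideal_def)

lemma (in cring) cgenideal_plusI:
  "r \<in> carrier R \<Longrightarrow> p \<in> P \<Longrightarrow> r \<otimes> x \<oplus> p \<in> PIdl x <+>\<^bsub>R\<^esub> P"
  by (auto simp: mem_cgenideal_plus)

lemma (in cring) cgenideal_plusE:
  assumes "y \<in> PIdl x <+>\<^bsub>R\<^esub> P"
  obtains r p where "r \<in> carrier R" "p \<in> P" "y = r \<otimes> x \<oplus> p"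
  using assms by (auto simp: mem_cgenideal_plus)

lemma (in cring) cgenideal_plus_ideal:
  assumes "ideal P R" "x \<in> carrier R"
  shows "ideal (PIdl x <+>\<^bsub>R\<^esub> P) R" "P \<subseteq> PIdl x <+>\<^bsub>R\<^esub> P" "x \<in> PIdl x <+>\<^bsub>R\<^esub> P"
proof -
  interpret P: ideal P R by fact
  show "ideal (PIdl x <+>\<^bsub>R\<^esub> P) R"
    using add_ideals[OF cgenideal_ideal[OF assms(2)] assms(1)] .
  show "P \<subseteq> PIdl x <+>\<^bsub>R\<^esub> P"
  proof
    fix p assume "p \<in> P"
    then have "p = \<zero> \<otimes> x \<oplus> p" using assms P.a_Hcarr by simp
    then show "p \<in> PIdl x <+>\<^bsub>R\<^esub> P" using \<open>p \<in> P\<close> by (auto simp: set_add_def' cgenideal_def)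
  qed
  have "x = \<one> \<otimes> x \<oplus> \<zero>" using assms by simp
  then show "x \<in> PIdl x <+>\<^bsub>R\<^esub> P"
    unfolding mem_cgenideal_plus using P.zero_closed by blast
qed

text \<open>Expanding (r x + p)(s y + q), every term has a factor xy, p or q in \<open>P\<close>.
  This computation makes maximal avoiding ideals prime.\<close>

lemma (in cring) set_mult_cgenideal_plus_subset:
  assumes "ideal P R" "x \<in> carrier R" "y \<in> carrier R" "x \<otimes> y \<in> P"
    and "A \<subseteq> PIdl x <+>\<^bsub>R\<^esub> P" "B \<subseteq> PIdl y <+>\<^bsub>R\<^esub> P"
  shows "A <#> B \<subseteq> P"
proof
  interpret P: ideal P R by fact
  fix z assume "z \<in> A <#> B"
  then obtain a b where "a \<in> A" "b \<in> B" and z: "z = a \<otimes> b"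
    by (auto simp: set_mult_def)
  then obtain r p s q where *: "r \<in> carrier R" "p \<in> P" "a = r \<otimes> x \<oplus> p"
    "s \<in> carrier R" "q \<in> P" "b = s \<otimes> y \<oplus> q"
    using assms(5,6) unfolding subset_iff mem_cgenideal_plus by meson
  have pq: "p \<in> carrier R" "q \<in> carrier R" using * P.a_Hcarr by auto
  have "z = (r \<otimes> s) \<otimes> (x \<otimes> y) \<oplus> ((r \<otimes> x \<oplus> p) \<otimes> q \<oplus> (s \<otimes> y) \<otimes> p)"
    unfolding z using * pq assms(2,3) by algebra
  moreover have "\<dots> \<in> P"
    using * pq assms(2-4) P.I_l_closed P.a_closed by simp
  ultimately show "z \<in> P" by simp
qed

section \<open>Prime ideals from Zorn's lemma\<close>

text \<open>This generalizes the avoidance of a multiplicative set, which is the case of singletons.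
  Zorn's lemma applies because a finite set inside the union of a chain lies in one ideal of the
  chain. Primality of a maximal \<open>P\<close> holds since for x, y outside \<open>P\<close> the
  ideals Rx + P and Ry + P contain members of \<open>\<G>\<close>, whose product would lie in
  \<open>P\<close> if xy did.\<close>

lemma (in cring) exists_prime_avoiding:
  assumes "\<G> \<noteq> {}" "\<And>A. A \<in> \<G> \<Longrightarrow> finite A" "\<And>A. A \<in> \<G> \<Longrightarrow> A \<subseteq> carrier R"
    and mult: "\<And>A B. A \<in> \<G> \<Longrightarrow> B \<in> \<G> \<Longrightarrow> A <#> B \<in> \<G>"
    and "ideal I R" "\<And>A. A \<in> \<G> \<Longrightarrow> \<not> A \<subseteq> I"
  obtains P where "primeideal P R" "I \<subseteq> P" "\<And>A. A \<in> \<G> \<Longrightarrow> \<not> A \<subseteq> P"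
    "\<And>N. ideal N R \<Longrightarrow> P \<subseteq> N \<Longrightarrow> (\<And>A. A \<in> \<G> \<Longrightarrow> \<not> A \<subseteq> N) \<Longrightarrow> N = P"
proof -
  define F where "F = {N. ideal N R \<and> I \<subseteq> N \<and> (\<forall>A\<in>\<G>. \<not> A \<subseteq> N)}"
  have "\<exists>P\<in>F. \<forall>N\<in>F. P \<subseteq> N \<longrightarrow> N = P"
  proof (rule subset_Zorn_nonempty)
    show "F \<noteq> {}" using assms by (auto simp: F_def)
    fix C assume C: "C \<noteq> {}" "subset.chain F C"
    have "subset.chain {I. ideal I R} C"
      using C(2) by (auto simp: pred_on.chain_def F_def)
    then have "ideal (\<Union>C) R" using chain_Union_is_ideal[of C] C(1) by simp
    moreover obtain N where "N \<in> C" using C(1) by blast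
    then have "I \<subseteq> \<Union>C" using C(2) unfolding pred_on.chain_def F_def by blast
    moreover have "\<not> A \<subseteq> \<Union>C" if A: "A \<in> \<G>" for A
    proof
      assume "A \<subseteq> \<Union>C"
      then obtain N where "N \<in> C" "A \<subseteq> N"
        using finite_subset_Union_chain[OF assms(2)[OF A] _ C] by metis
      then show False using C(2) A by (auto simp: pred_on.chain_def F_def)
    qed
    ultimately show "\<Union>C \<in> F" by (auto simp: F_def)
  qed
  then obtain P where P: "P \<in> F" and max: "\<And>N. N \<in> F \<Longrightarrow> P \<subseteq> N \<Longrightarrow> N = P"
    by metis
  then have idl: "ideal P R" and avoid: "\<And>A. A \<in> \<G> \<Longrightarrow> \<not> A \<subseteq> P" and IP: "I \<subseteq> P"
    by (auto simp: F_def)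
  interpret P: ideal P R by fact
  \<comment> \<open>By maximality, the strictly larger ideal Rx + P can no longer avoid
    \<open>\<G>\<close>.\<close>
  have ex: "\<exists>A\<in>\<G>. A \<subseteq> PIdl x <+>\<^bsub>R\<^esub> P" if x: "x \<in> carrier R" "x \<notin> P" for x
  proof (rule ccontr)
    note Q = cgenideal_plus_ideal[OF idl x(1)]
    assume "\<not> (\<exists>A\<in>\<G>. A \<subseteq> PIdl x <+>\<^bsub>R\<^esub> P)"
    then have "PIdl x <+>\<^bsub>R\<^esub> P \<in> F"
      using Q(1) subset_trans[OF IP Q(2)] by (simp add: F_def)
    then show False using max[OF _ Q(2)] Q(3) x(2) by blast
  qed
  have "primeideal P R"
  proof (rule primeidealI[OF idl is_cring])
    show "carrier R \<noteq> P" using assms(1,3) avoid by blast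
    fix x y assume xy: "x \<in> carrier R" "y \<in> carrier R" "x \<otimes> y \<in> P"
    show "x \<in> P \<or> y \<in> P"
    proof (rule ccontr)
      assume "\<not> (x \<in> P \<or> y \<in> P)"
      then have "x \<notin> P" "y \<notin> P" by auto
      obtain A where A: "A \<in> \<G>" "A \<subseteq> PIdl x <+>\<^bsub>R\<^esub> P"
        using ex[OF xy(1) \<open>x \<notin> P\<close>] by blast
      obtain B where B: "B \<in> \<G>" "B \<subseteq> PIdl y <+>\<^bsub>R\<^esub> P"
        using ex[OF xy(2) \<open>y \<notin> P\<close>] by blast
      show False
        using set_mult_cgenideal_plus_subset[OF idl xy A(2) B(2)] avoid[OF mult[OF A(1) B(1)]] by blast
    qed
  qed
  then show thesis
  proof (rule that[OF _ IP avoid])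
    fix N assume N: "ideal N R" "P \<subseteq> N" "\<And>A. A \<in> \<G> \<Longrightarrow> \<not> A \<subseteq> N"
    then have "N \<in> F" using subset_trans[OF IP N(2)] by (simp add: F_def)
    then show "N = P" using max N(2) by blast
  qed
qed

lemma (in cring) exists_prime_ideal:
  assumes "ideal I R" "\<one> \<notin> I"
  obtains P where "primeideal P R" "I \<subseteq> P"
proof (rule exists_prime_avoiding[of "{{\<one>}}" I])
  show "A <#> B \<in> {{\<one>}}" if "A \<in> {{\<one>}}" "B \<in> {{\<one>}}" for A B
    using that by (auto simp: set_mult_def)
qed (use assms that in auto)

text \<open>The maximal ideal of the localization at a minimal prime is nil. Without localizing: if
  no s a^n with s outside \<open>P\<close> were zero, some prime \<open>Q\<close> would avoid them
  all. The exponent 0 forces \<open>Q\<close> into \<open>P\<close>, and s = 1 keeps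
  \<open>a\<close> out of \<open>Q\<close>, against minimality.\<close>

lemma (in cring) minimal_prime_nilpotent:
  assumes "primeideal P R" "\<And>Q. primeideal Q R \<Longrightarrow> \<not> Q \<subset> P" "a \<in> P"
  obtains s n where "s \<in> carrier R" "s \<notin> P" "s \<otimes> a [^] (n::nat) = \<zero>"
proof -
  interpret P: primeideal P R by fact
  have a: "a \<in> carrier R" using assms(3) P.a_Hcarr by auto
  \<comment> \<open>Singletons encode the multiplicative set of all s a^n as a family to be
    avoided.\<close>
  define \<G> where "\<G> = {{s \<otimes> a [^] n} | s (n::nat). s \<in> carrier R - P}"
  have "\<exists>A\<in>\<G>. A \<subseteq> {\<zero>}"
  proof (rule ccontr)
    assume contra: "\<not> (\<exists>A\<in>\<G>. A \<subseteq> {\<zero>})"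
    have one: "\<one> \<in> carrier R - P" using P.I_notcarr P.one_imp_carrier by auto
    obtain Q where Q: "primeideal Q R" "\<And>A. A \<in> \<G> \<Longrightarrow> \<not> A \<subseteq> Q"
    proof (rule exists_prime_avoiding[of \<G> "{\<zero>}"])
      show "\<G> \<noteq> {}" using one by (auto simp: \<G>_def)
      show "A <#> B \<in> \<G>" if AB: "A \<in> \<G>" "B \<in> \<G>" for A B
      proof -
        obtain s t m n where st: "s \<in> carrier R - P" "t \<in> carrier R - P"
          and A: "A = {s \<otimes> a [^] (m::nat)}" and B: "B = {t \<otimes> a [^] (n::nat)}"
          using AB by (auto simp: \<G>_def)
        have "(s \<otimes> a [^] m) \<otimes> (t \<otimes> a [^] n) = (s \<otimes> t) \<otimes> (a [^] m \<otimes> a [^] n)"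
          using st a by (simp add: m_ac)
        then have "A <#> B = {(s \<otimes> t) \<otimes> a [^] (m + n)}"
          using a by (auto simp: A B set_mult_def nat_pow_mult)
        moreover have "s \<otimes> t \<in> carrier R - P" using st P.I_prime by auto
        ultimately show ?thesis unfolding \<G>_def by blast
      qed
    qed (use contra a zeroideal in \<open>auto simp: \<G>_def\<close>)
    interpret Q: primeideal Q R by fact
    have "Q \<subseteq> P"
    proof
      fix q assume q: "q \<in> Q"
      then have "q \<in> carrier R" using Q.a_Hcarr by auto
      show "q \<in> P"
      proof (rule ccontr)
        assume "q \<notin> P"
        then have "{q \<otimes> a [^] (0::nat)} \<in> \<G>" using \<open>q \<in> carrier R\<close> unfolding \<G>_def by blast
        then show False using Q(2) q \<open>q \<in> carrier R\<close> by fastforce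
      qed
    qed
    moreover have "{\<one> \<otimes> a [^] (1::nat)} \<in> \<G>" using one unfolding \<G>_def by blast
    then have "a \<notin> Q" using Q(2) a by fastforce
    ultimately show False using assms(2)[OF Q(1)] assms(3) by blast
  qed
  then show thesis using that by (auto simp: \<G>_def)
qed

section \<open>Ideals \<open>J\<close> for which the natural map from R to Hom(J, R) is
  bijective\<close>

lemma (in cring) bij_homothety_iff:
  assumes "ideal J R"
  shows "bij_betw (homothety R J) (carrier R) (Hom_to_ring R J) \<longleftrightarrow>
    (\<forall>x\<in>carrier R. (\<forall>a\<in>J. x \<otimes> a = \<zero>) \<longrightarrow> x = \<zero>) \<and>
    (\<forall>f\<in>Hom_to_ring R J. \<exists>c\<in>carrier R. \<forall>a\<in>J. f a = c \<otimes> a)" (is "_ \<longleftrightarrow> ?inj \<and> ?surj")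
proof -
  interpret J: ideal J R by fact
  have "inj_on (homothety R J) (carrier R) \<longleftrightarrow> ?inj"
  proof
    assume inj: "inj_on (homothety R J) (carrier R)"
    show ?inj
    proof (intro ballI impI)
      fix x assume "x \<in> carrier R" "\<forall>a\<in>J. x \<otimes> a = \<zero>"
      then have "homothety R J x = homothety R J \<zero>"
        using J.a_Hcarr by (auto simp: homothety_def restrict_def)
      then show "x = \<zero>" using inj \<open>x \<in> carrier R\<close> by (auto dest: inj_onD)
    qed
  next
    assume ?inj
    show "inj_on (homothety R J) (carrier R)"
    proof (rule inj_onI)
      fix x y assume xy: "x \<in> carrier R" "y \<in> carrier R" "homothety R J x = homothety R J y"
      have "(x \<ominus> y) \<otimes> a = \<zero>" if "a \<in> J" for a
      proof -
        have "a \<in> carrier R" using that J.a_Hcarr by auto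
        moreover have "x \<otimes> a = y \<otimes> a"
          using fun_cong[OF xy(3), of a] that by (simp add: homothety_def)
        ultimately show ?thesis
          using xy by (simp add: a_minus_def l_distr l_minus r_neg)
      qed
      then have "x \<ominus> y = \<zero>" using \<open>?inj\<close> xy by simp
      then show "x = y" using xy by simp
    qed
  qed
  moreover have "homothety R J ` carrier R = Hom_to_ring R J \<longleftrightarrow> ?surj"
  proof
    assume "homothety R J ` carrier R = Hom_to_ring R J"
    then have "\<exists>c\<in>carrier R. f = homothety R J c" if "f \<in> Hom_to_ring R J" for f
      using that by blast
    then show ?surj by (fastforce simp: homothety_def)
  next
    assume surj: ?surj
    have "f \<in> homothety R J ` carrier R" if f: "f \<in> Hom_to_ring R J" for f
    proof -
      obtain c where "c \<in> carrier R" "\<forall>a\<in>J. f a = c \<otimes> a" using surj f by blast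
      moreover have "f \<in> extensional J" using f by (auto simp: Hom_to_ring_def PiE_def)
      ultimately have "f = homothety R J c"
        by (auto simp: homothety_def intro!: extensionalityI[of _ J])
      then show ?thesis using \<open>c \<in> carrier R\<close> by blast
    qed
    then show "homothety R J ` carrier R = Hom_to_ring R J"
      using homothety_in_Hom[OF assms] by blast
  qed
  ultimately show ?thesis by (simp add: bij_betw_def)
qed

text \<open>This is the GV condition without finite generation. It is needed in this generality for
  ideals such as Ra + ann(a^n), which contain a GV-ideal but need not be finitely generated.\<close>

definition all_homs_homotheties :: "('a, 'm) ring_scheme \<Rightarrow> 'a set \<Rightarrow> bool" where
  "all_homs_homotheties R J \<longleftrightarrow>
     ideal J R \<and> bij_betw (homothety R J) (carrier R) (Hom_to_ring R J)"

text \<open>The third fact is injectivity as cancellation: elements are equal once their multiples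
  by all of \<open>J\<close> agree. In the fourth, \<open>f\<close> may be arbitrary off
  \<open>J\<close>, since only its restriction is a member of
  \<open>Hom_to_ring R J\<close>.\<close>

lemma (in cring) all_homs_homothetiesD:
  assumes "all_homs_homotheties R J"
  shows "ideal J R"
    and "x \<in> carrier R \<Longrightarrow> (\<And>a. a \<in> J \<Longrightarrow> x \<otimes> a = \<zero>) \<Longrightarrow> x = \<zero>"
    and "x \<in> carrier R \<Longrightarrow> y \<in> carrier R \<Longrightarrow> (\<And>a. a \<in> J \<Longrightarrow> a \<otimes> x = a \<otimes> y) \<Longrightarrow> x = y"
    and "(\<And>a. a \<in> J \<Longrightarrow> f a \<in> carrier R) \<Longrightarrow>
      (\<And>a b. a \<in> J \<Longrightarrow> b \<in> J \<Longrightarrow> f (a \<oplus> b) = f a \<oplus> f b) \<Longrightarrow>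
      (\<And>r a. r \<in> carrier R \<Longrightarrow> a \<in> J \<Longrightarrow> f (r \<otimes> a) = r \<otimes> f a) \<Longrightarrow>
      \<exists>c\<in>carrier R. \<forall>a\<in>J. f a = c \<otimes> a"
proof -
  show J: "ideal J R" using assms by (simp add: all_homs_homotheties_def)
  interpret J: ideal J R by fact
  note D = bij_homothety_iff[OF J, THEN iffD1, OF conjunct2,
      OF assms[unfolded all_homs_homotheties_def]]
  show zero: "x = \<zero>" if "x \<in> carrier R" "\<And>a. a \<in> J \<Longrightarrow> x \<otimes> a = \<zero>" for x
    using D that by blast
  show "x = y" if xy: "x \<in> carrier R" "y \<in> carrier R" "\<And>a. a \<in> J \<Longrightarrow> a \<otimes> x = a \<otimes> y"
  proof -
    have "(x \<ominus> y) \<otimes> a = \<zero>" if "a \<in> J" for a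
    proof -
      have a: "a \<in> carrier R" using that J.a_Hcarr by auto
      have "(x \<ominus> y) \<otimes> a = a \<otimes> x \<ominus> a \<otimes> y" using xy(1,2) a by algebra
      then show ?thesis using xy(1,2) xy(3)[OF that] a by simp
    qed
    then have "x \<ominus> y = \<zero>" using zero xy by simp
    then show "x = y" using xy by simp
  qed
  assume f: "\<And>a. a \<in> J \<Longrightarrow> f a \<in> carrier R"
    "\<And>a b. a \<in> J \<Longrightarrow> b \<in> J \<Longrightarrow> f (a \<oplus> b) = f a \<oplus> f b"
    "\<And>r a. r \<in> carrier R \<Longrightarrow> a \<in> J \<Longrightarrow> f (r \<otimes> a) = r \<otimes> f a"
  have "restrict f J \<in> Hom_to_ring R J"
    using f J.a_closed J.I_l_closed by (auto simp: Hom_to_ring_def)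
  then show "\<exists>c\<in>carrier R. \<forall>a\<in>J. f a = c \<otimes> a" using D by fastforce
qed

lemma (in cring) all_homs_homothetiesI:
  assumes "ideal J R"
    and "\<And>x. x \<in> carrier R \<Longrightarrow> (\<And>a. a \<in> J \<Longrightarrow> x \<otimes> a = \<zero>) \<Longrightarrow> x = \<zero>"
    and "\<And>f. (\<And>a. a \<in> J \<Longrightarrow> f a \<in> carrier R) \<Longrightarrow>
      (\<And>a b. a \<in> J \<Longrightarrow> b \<in> J \<Longrightarrow> f (a \<oplus> b) = f a \<oplus> f b) \<Longrightarrow>
      (\<And>r a. r \<in> carrier R \<Longrightarrow> a \<in> J \<Longrightarrow> f (r \<otimes> a) = r \<otimes> f a) \<Longrightarrow>
      \<exists>c\<in>carrier R. \<forall>a\<in>J. f a = c \<otimes> a"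
  shows "all_homs_homotheties R J"
  unfolding all_homs_homotheties_def bij_homothety_iff[OF assms(1)]
proof (intro conjI ballI impI)
  show "x = \<zero>" if "x \<in> carrier R" "\<forall>a\<in>J. x \<otimes> a = \<zero>" for x
    using assms(2) that by blast
  show "\<exists>c\<in>carrier R. \<forall>a\<in>J. f a = c \<otimes> a" if "f \<in> Hom_to_ring R J" for f
    by (rule assms(3)) (use that in \<open>auto simp: Hom_to_ring_def\<close>)
qed (rule assms(1))

lemma (in cring) all_homs_homotheties_carrier: "all_homs_homotheties R (carrier R)"
proof (rule all_homs_homothetiesI[OF oneideal])
  show "x = \<zero>" if "x \<in> carrier R" "\<And>a. a \<in> carrier R \<Longrightarrow> x \<otimes> a = \<zero>" for x
    using that(2)[of \<one>] that(1) by simp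
  fix f assume f: "\<And>a. a \<in> carrier R \<Longrightarrow> f a \<in> carrier R"
    "\<And>r a. r \<in> carrier R \<Longrightarrow> a \<in> carrier R \<Longrightarrow> f (r \<otimes> a) = r \<otimes> f a"
  have "f a = f \<one> \<otimes> a" if "a \<in> carrier R" for a
    using f(2)[of a \<one>] f(1)[of \<one>] that by (simp add: m_comm)
  then show "\<exists>c\<in>carrier R. \<forall>a\<in>carrier R. f a = c \<otimes> a" using f(1) by blast
qed

text \<open>Behind this is the adjunction Hom(I \<otimes> J, R) = Hom(I, Hom(J, R)) = Hom(I, R) = R.
  For fixed a in \<open>I\<close>, the map b \<mapsto> f(ab) on \<open>J\<close> is multiplication
  by some \<open>e a\<close>; then \<open>e\<close> is linear on \<open>I\<close>, hence
  multiplication by some \<open>c\<close>.\<close>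

lemma (in cring) all_homs_homotheties_product:
  assumes "all_homs_homotheties R I" "all_homs_homotheties R J" "ideal K R"
    and prod: "\<And>a b. a \<in> I \<Longrightarrow> b \<in> J \<Longrightarrow> a \<otimes> b \<in> K"
  shows "all_homs_homotheties R K"
proof (rule all_homs_homothetiesI[OF assms(3)])
  note I = all_homs_homothetiesD[OF assms(1)] and J = all_homs_homothetiesD[OF assms(2)]
  interpret I: ideal I R by (rule I)
  interpret J: ideal J R by (rule J)
  interpret K: ideal K R by fact
  note carr[simp] = I.a_Hcarr J.a_Hcarr K.a_Hcarr
  show zero: "x = \<zero>" if x: "x \<in> carrier R" "\<And>a. a \<in> K \<Longrightarrow> x \<otimes> a = \<zero>" for x
  proof (rule I(2)[OF x(1)])
    fix a assume a: "a \<in> I"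
    show "x \<otimes> a = \<zero>"
    proof (rule J(2))
      show "(x \<otimes> a) \<otimes> b = \<zero>" if "b \<in> J" for b
        using x(2)[OF prod[OF a that]] x(1) a that by (simp add: m_assoc)
    qed (use x a in simp)
  qed
  fix f assume f: "\<And>a. a \<in> K \<Longrightarrow> f a \<in> carrier R"
    "\<And>a b. a \<in> K \<Longrightarrow> b \<in> K \<Longrightarrow> f (a \<oplus> b) = f a \<oplus> f b"
    "\<And>r a. r \<in> carrier R \<Longrightarrow> a \<in> K \<Longrightarrow> f (r \<otimes> a) = r \<otimes> f a"
  have "\<exists>c\<in>carrier R. \<forall>b\<in>J. f (a \<otimes> b) = c \<otimes> b" if a: "a \<in> I" for a
  proof (rule J(4))
    show "f (a \<otimes> b) \<in> carrier R" if "b \<in> J" for b using f(1) prod a that by simp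
    show "f (a \<otimes> (b \<oplus> b')) = f (a \<otimes> b) \<oplus> f (a \<otimes> b')" if "b \<in> J" "b' \<in> J" for b b'
      using f(2) prod a that by (simp add: r_distr)
    show "f (a \<otimes> (r \<otimes> b)) = r \<otimes> f (a \<otimes> b)" if "r \<in> carrier R" "b \<in> J" for r b
      using f(3)[OF that(1) prod[OF a that(2)]] a that by (simp add: m_lcomm)
  qed
  then obtain e where e: "\<And>a. a \<in> I \<Longrightarrow> e a \<in> carrier R"
    "\<And>a b. a \<in> I \<Longrightarrow> b \<in> J \<Longrightarrow> f (a \<otimes> b) = e a \<otimes> b" by metis
  have "\<exists>c\<in>carrier R. \<forall>a\<in>I. e a = c \<otimes> a"
  proof (rule I(4))
    show "e a \<in> carrier R" if "a \<in> I" for a using e that by simp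
    \<comment> \<open>Linearity of \<open>e\<close> is inherited from \<open>f\<close> after
      multiplying by an arbitrary b in \<open>J\<close>, which can be cancelled.\<close>
    show "e (a \<oplus> a') = e a \<oplus> e a'" if a: "a \<in> I" "a' \<in> I" for a a'
    proof (rule J(3))
      fix b assume b: "b \<in> J"
      have "e (a \<oplus> a') \<otimes> b = f (a \<otimes> b \<oplus> a' \<otimes> b)"
        using e(2)[of "a \<oplus> a'" b] a b I.a_closed by (simp add: l_distr)
      also have "\<dots> = e a \<otimes> b \<oplus> e a' \<otimes> b"
        using f(2) prod e(2) a b by simp
      finally show "b \<otimes> e (a \<oplus> a') = b \<otimes> (e a \<oplus> e a')"
        using a b e(1) I.a_closed by (simp add: m_comm r_distr)
    qed (use a e(1) I.a_closed in auto)
    show "e (r \<otimes> a) = r \<otimes> e a" if a: "r \<in> carrier R" "a \<in> I" for r a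
    proof (rule J(3))
      fix b assume b: "b \<in> J"
      have "e (r \<otimes> a) \<otimes> b = f (r \<otimes> (a \<otimes> b))"
        using e(2)[of "r \<otimes> a" b] a b I.I_l_closed by (simp add: m_assoc)
      also have "\<dots> = r \<otimes> (e a \<otimes> b)"
        using f(3) prod e(2) a b by simp
      finally show "b \<otimes> e (r \<otimes> a) = b \<otimes> (r \<otimes> e a)"
        using a b e(1) I.I_l_closed by (simp add: m_ac)
    qed (use a e(1) I.I_l_closed in auto)
  qed
  then obtain c where c: "c \<in> carrier R" "\<And>a. a \<in> I \<Longrightarrow> e a = c \<otimes> a" by blast
  \<comment> \<open>So far \<open>f\<close> is known only on products ab. An arbitrary k is reduced
    to these by multiplying with a and b, because bk lies in \<open>J\<close>; both factors are then
    cancelled.\<close>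
  have "f k = c \<otimes> k" if k: "k \<in> K" for k
  proof (rule I(3))
    fix a assume a: "a \<in> I"
    show "a \<otimes> f k = a \<otimes> (c \<otimes> k)"
    proof (rule J(3))
      fix b assume b: "b \<in> J"
      have "b \<otimes> (a \<otimes> f k) = f ((b \<otimes> a) \<otimes> k)"
        using f(3)[of "b \<otimes> a" k] f(1) a b k by (simp add: m_assoc)
      also have "(b \<otimes> a) \<otimes> k = a \<otimes> (b \<otimes> k)"
        using a b k by (simp add: m_ac)
      also have "f \<dots> = c \<otimes> a \<otimes> (b \<otimes> k)"
        using e(2)[of a "b \<otimes> k"] c(2) a b k J.I_r_closed by simp
      also have "\<dots> = b \<otimes> (a \<otimes> (c \<otimes> k))"
        using a b k c by (simp add: m_ac)
      finally show "b \<otimes> (a \<otimes> f k) = b \<otimes> (a \<otimes> (c \<otimes> k))" .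
    qed (use a k c f(1) in auto)
  qed (use k c f(1) in auto)
  then show "\<exists>c\<in>carrier R. \<forall>a\<in>K. f a = c \<otimes> a" using c by blast
qed

text \<open>The product lemma with R as first factor: an ideal containing \<open>J\<close> contains
  all products of ring elements with elements of \<open>J\<close>.\<close>

lemma (in cring) all_homs_homotheties_superset:
  assumes "all_homs_homotheties R J" "ideal K R" "J \<subseteq> K"
  shows "all_homs_homotheties R K"
proof (rule all_homs_homotheties_product[OF all_homs_homotheties_carrier assms(1,2)])
  show "a \<otimes> b \<in> K" if "a \<in> carrier R" "b \<in> J" for a b
    using that assms(3) ideal.I_l_closed[OF assms(2)] by blast
qed

text \<open>For any set \<open>S\<close>, the elements that multiply \<open>S\<close> into a fixed
  ideal form an ideal. Minimality of generated ideals, used with S = B and then with S = Idl A,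
  extends the claim from generators to both ideals.\<close>

lemma (in cring) genideal_set_mult:
  assumes "A \<subseteq> carrier R" "B \<subseteq> carrier R" "x \<in> Idl A" "y \<in> Idl B"
  shows "x \<otimes> y \<in> Idl (A <#> B)"
proof -
  define K where "K = Idl (A <#> B)"
  have sub: "A <#> B \<subseteq> carrier R" using set_mult_closed assms by blast
  interpret K: ideal K R unfolding K_def by (rule genideal_ideal[OF sub])
  have gen: "a \<otimes> b \<in> K" if "a \<in> A" "b \<in> B" for a b
    using genideal_self[OF sub] that unfolding K_def set_mult_def by blast
  have colon: "ideal {z\<in>carrier R. \<forall>s\<in>S. z \<otimes> s \<in> K} R" if "S \<subseteq> carrier R" for S
  proof (rule cring_idealI)
    fix r z assume rz: "r \<in> carrier R" "z \<in> {z\<in>carrier R. \<forall>s\<in>S. z \<otimes> s \<in> K}"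
    have "r \<otimes> z \<otimes> s \<in> K" if "s \<in> S" for s
    proof -
      have "s \<in> carrier R" using that \<open>S \<subseteq> carrier R\<close> by blast
      then have "r \<otimes> z \<otimes> s = r \<otimes> (z \<otimes> s)" using rz by (simp add: m_assoc)
      then show ?thesis using rz K.I_l_closed that by simp
    qed
    then show "r \<otimes> z \<in> {z\<in>carrier R. \<forall>s\<in>S. z \<otimes> s \<in> K}" using rz by simp
  qed (use that in \<open>auto simp: l_distr subset_iff\<close>)
  have "Idl A \<subseteq> {z\<in>carrier R. \<forall>s\<in>B. z \<otimes> s \<in> K}"
    by (rule genideal_minimal[OF colon[OF assms(2)]]) (use gen assms(1) in blast)
  moreover have xc: "Idl A \<subseteq> carrier R"
    using ideal.Icarr[OF genideal_ideal[OF assms(1)]] by blast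
  ultimately have "s \<otimes> z \<in> K" "s \<in> carrier R" "z \<in> carrier R" if "z \<in> B" "s \<in> Idl A" for z s
    using that assms(2) by blast+
  then have "z \<otimes> s \<in> K" if "z \<in> B" "s \<in> Idl A" for z s
    using that m_comm by metis
  then have "B \<subseteq> {z\<in>carrier R. \<forall>s\<in>Idl A. z \<otimes> s \<in> K}"
    using assms(2) by blast
  then have "Idl B \<subseteq> {z\<in>carrier R. \<forall>s\<in>Idl A. z \<otimes> s \<in> K}"
    by (rule genideal_minimal[OF colon[OF xc]])
  then have "y \<in> carrier R" "y \<otimes> x \<in> K" using assms(3,4) by blast+
  then show ?thesis using assms(3) xc m_comm[of x y] unfolding K_def by auto
qed

section \<open>GV-ideals and maximal \<open>w\<close>-ideals\<close>

lemma (in cring) GV_idealE: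
  assumes "GV_ideal R J"
  obtains A where "finite A" "A \<subseteq> carrier R" "J = Idl A" "all_homs_homotheties R J"
  using assms genideal_ideal
  by (auto simp: GV_ideal_def fg_ideal_def all_homs_homotheties_def)

lemma (in cring) GV_ideal_is_ideal: "GV_ideal R J \<Longrightarrow> ideal J R"
  using genideal_ideal by (auto simp: GV_ideal_def fg_ideal_def)

lemma (in cring) GV_ideal_genideal_iff:
  assumes "finite A" "A \<subseteq> carrier R"
  shows "GV_ideal R (Idl A) \<longleftrightarrow> all_homs_homotheties R (Idl A)"
  using assms genideal_ideal
  by (auto simp: GV_ideal_def fg_ideal_def all_homs_homotheties_def)

lemma (in cring) GV_ideal_carrier: "GV_ideal R (carrier R)"
  using GV_ideal_genideal_iff[of "{\<one>}"] all_homs_homotheties_carrier by (simp add: genideal_one)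

lemma (in cring) finite_set_mult: "finite A \<Longrightarrow> finite B \<Longrightarrow> finite (A <#> B)"
  by (simp add: set_mult_def)

text \<open>An ideal maximal among those containing no GV-ideal is a prime \<open>w\<close>-ideal,
  and it is a maximal one because a proper \<open>w\<close>-ideal contains no GV-ideal
  either.\<close>

lemma (in cring) contained_in_prime_maximal_w_ideal:
  assumes "ideal I R" "\<And>J. GV_ideal R J \<Longrightarrow> \<not> J \<subseteq> I"
  obtains M where "maximal_w_ideal R M" "primeideal M R" "I \<subseteq> M"
proof -
  \<comment> \<open>Avoidance requires finite sets, so GV-ideals are represented by finite
    generating sets; an ideal contains a GV-ideal iff it contains one of these.\<close>
  define \<G> where "\<G> = {A. finite A \<and> A \<subseteq> carrier R \<and> GV_ideal R (Idl A)}"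
  have GV: "(\<exists>A\<in>\<G>. A \<subseteq> N) \<longleftrightarrow> (\<exists>J. GV_ideal R J \<and> J \<subseteq> N)" if "ideal N R" for N
  proof
    assume "\<exists>A\<in>\<G>. A \<subseteq> N"
    then show "\<exists>J. GV_ideal R J \<and> J \<subseteq> N"
      using genideal_minimal[OF that] by (auto simp: \<G>_def)
  next
    assume "\<exists>J. GV_ideal R J \<and> J \<subseteq> N"
    then obtain J where J: "GV_ideal R J" "J \<subseteq> N" by blast
    from J(1) obtain A where "finite A" "A \<subseteq> carrier R" "J = Idl A" by (rule GV_idealE)
    then show "\<exists>A\<in>\<G>. A \<subseteq> N"
      using J genideal_self[of A] by (auto simp: \<G>_def)
  qed
  obtain M where M: "primeideal M R" "I \<subseteq> M" "\<And>A. A \<in> \<G> \<Longrightarrow> \<not> A \<subseteq> M"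
    and max: "\<And>N. ideal N R \<Longrightarrow> M \<subseteq> N \<Longrightarrow> (\<And>A. A \<in> \<G> \<Longrightarrow> \<not> A \<subseteq> N) \<Longrightarrow> N = M"
  proof (rule exists_prime_avoiding[of \<G> I])
    show "\<G> \<noteq> {}" using GV[OF oneideal] GV_ideal_carrier by blast
    show "A <#> B \<in> \<G>" if "A \<in> \<G>" "B \<in> \<G>" for A B
    proof -
      have AB: "finite A" "finite B" "A \<subseteq> carrier R" "B \<subseteq> carrier R"
        "all_homs_homotheties R (Idl A)" "all_homs_homotheties R (Idl B)"
        using that by (auto simp: \<G>_def GV_ideal_genideal_iff)
      then have "finite (A <#> B)" "A <#> B \<subseteq> carrier R"
        using finite_set_mult set_mult_closed by auto
      moreover from this have "all_homs_homotheties R (Idl (A <#> B))"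
        using all_homs_homotheties_product[OF AB(5,6)] genideal_ideal genideal_set_mult AB
        by blast
      ultimately show ?thesis by (simp add: \<G>_def GV_ideal_genideal_iff)
    qed
    show "\<not> A \<subseteq> I" if "A \<in> \<G>" for A using GV[OF assms(1)] assms(2) that by blast
  qed (use assms(1) in \<open>auto simp: \<G>_def\<close>)
  interpret M: primeideal M R by fact
  have "w_closure R M = M"
  proof
    show "M \<subseteq> w_closure R M"
      using GV_ideal_carrier M.I_l_closed M.a_Hcarr unfolding w_closure_def by blast
    show "w_closure R M \<subseteq> M"
    proof
      fix x assume "x \<in> w_closure R M"
      then obtain J where x: "x \<in> carrier R" and J: "GV_ideal R J" "\<forall>a\<in>J. a \<otimes> x \<in> M"
        by (auto simp: w_closure_def)
      have "\<not> J \<subseteq> M" using GV[OF M.is_ideal] M(3) J(1) by blast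
      \<comment> \<open>Since ax lies in the prime \<open>M\<close> and a does not, x must.\<close>
      then obtain a where a: "a \<in> J" "a \<notin> M" by blast
      have "a \<in> carrier R"
        using GV_ideal_is_ideal[OF J(1)] a(1) by (rule ideal.Icarr)
      then show "x \<in> M" using M.I_prime[of a x] J(2) a x by blast
    qed
  qed
  moreover have "N = M" if N: "w_ideal R N" "N \<noteq> carrier R" "M \<subseteq> N" for N
  proof (rule max)
    show idl: "ideal N R" using N by (simp add: w_ideal_def)
    show "\<not> A \<subseteq> N" if A: "A \<in> \<G>" for A
    proof
      assume "A \<subseteq> N"
      then obtain J where J: "GV_ideal R J" "J \<subseteq> N" using GV[OF idl] A by blast
      \<comment> \<open>A GV-ideal inside \<open>N\<close> witnesses that \<open>\<one>\<close> is
        in the closure of \<open>N\<close>, so \<open>N\<close> would be the whole ring.\<close>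
      have "a \<otimes> \<one> \<in> N" if "a \<in> J" for a
        using J(2) that ideal.Icarr[OF idl, of a] by auto
      then have "\<one> \<in> w_closure R N" using J(1) by (auto simp: w_closure_def)
      then have "\<one> \<in> N" using N(1) by (simp add: w_ideal_def)
      then show False using N(2) ideal.one_imp_carrier[OF idl] by blast
    qed
  qed (rule N)
  ultimately have "maximal_w_ideal R M"
    using M.is_ideal M.I_notcarr unfolding maximal_w_ideal_def w_ideal_def by blast
  then show thesis using that M by blast
qed

section \<open>Minimal primes, power torsion and strong \<pi>-regularity\<close>

lemma height_nonpos_imp_minimal:
  assumes "prime_height R M \<le> 0" "primeideal M R" "primeideal Q R"
  shows "\<not> Q \<subset> M"
proof
  assume "Q \<subset> M"
  then have "prime_chain R 1 (\<lambda>i. if i = 0 then Q else M)"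
    using assms by (auto simp: prime_chain_def)
  then have "ereal (real 1) \<le> prime_height R M"
    unfolding prime_height_def by (intro Sup_upper) force
  with assms(1) have "ereal (real 1) \<le> 0" by (rule order_trans[rotated])
  then show False by simp
qed

lemma (in cring) annihilator_ideal:
  assumes "x \<in> carrier R"
  shows "ideal {s\<in>carrier R. s \<otimes> x = \<zero>} R"
  by (rule cring_idealI) (use assms in \<open>auto simp: l_distr m_assoc\<close>)

lemma (in cring) annihilator_nat_pow_mono:
  assumes "a \<in> carrier R" "s \<in> carrier R" "s \<otimes> a [^] m = \<zero>" "m \<le> (n::nat)"
  shows "s \<otimes> a [^] n = \<zero>"
proof -
  have "a [^] n = a [^] m \<otimes> a [^] (n - m)" using assms by (simp add: nat_pow_mult)
  then have "s \<otimes> a [^] n = s \<otimes> a [^] m \<otimes> a [^] (n - m)" using assms by (simp add: m_assoc[symmetric])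
  then show ?thesis using assms by simp
qed

text \<open>This set is the kernel of the localization map from R to R[1/a], the increasing union of
  the annihilators of the powers of \<open>a\<close>.\<close>

lemma (in cring) nat_pow_torsion_ideal:
  assumes "a \<in> carrier R"
  shows "ideal {s\<in>carrier R. \<exists>n::nat. s \<otimes> a [^] n = \<zero>} R"
proof (rule cring_idealI)
  fix s t assume st: "s \<in> {s\<in>carrier R. \<exists>n::nat. s \<otimes> a [^] n = \<zero>}"
    "t \<in> {s\<in>carrier R. \<exists>n::nat. s \<otimes> a [^] n = \<zero>}"
  then obtain m n :: nat where "s \<otimes> a [^] m = \<zero>" "t \<otimes> a [^] n = \<zero>" by blast
  then have "s \<otimes> a [^] (max m n) = \<zero>" "t \<otimes> a [^] (max m n) = \<zero>"
    using annihilator_nat_pow_mono[OF assms] st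
    by (metis (no_types, lifting) max.cobounded1 max.cobounded2 mem_Collect_eq)+
  then have "(s \<oplus> t) \<otimes> a [^] (max m n) = \<zero>" using assms st by (simp add: l_distr)
  then show "s \<oplus> t \<in> {s\<in>carrier R. \<exists>n::nat. s \<otimes> a [^] n = \<zero>}" using st by blast
next
  fix r s assume "r \<in> carrier R" "s \<in> {s\<in>carrier R. \<exists>n::nat. s \<otimes> a [^] n = \<zero>}"
  then show "r \<otimes> s \<in> {s\<in>carrier R. \<exists>n::nat. s \<otimes> a [^] n = \<zero>}"
    using assms by (auto simp: m_assoc) (metis r_null)
qed (use assms in auto)

text \<open>Finitely many elements involve finitely many torsion parts, all killed by the largest of
  the exponents. Finite generation of GV-ideals enters the argument here.\<close>

lemma (in cring) finite_subset_nat_pow_torsion: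
  assumes a: "a \<in> carrier R" and "finite A"
    and "A \<subseteq> PIdl x <+>\<^bsub>R\<^esub> {s\<in>carrier R. \<exists>n::nat. s \<otimes> a [^] n = \<zero>}"
  shows "\<exists>n::nat. A \<subseteq> PIdl x <+>\<^bsub>R\<^esub> {s\<in>carrier R. s \<otimes> a [^] n = \<zero>}"
  using assms(2,3)
proof (induction A)
  case empty
  then show ?case by simp
next
  case (insert y A)
  then obtain n r s m where n: "A \<subseteq> PIdl x <+>\<^bsub>R\<^esub> {s\<in>carrier R. s \<otimes> a [^] (n::nat) = \<zero>}"
    and y: "y = r \<otimes> x \<oplus> s" "r \<in> carrier R" "s \<in> carrier R" "s \<otimes> a [^] (m::nat) = \<zero>"
    by (auto simp: mem_cgenideal_plus)
  have mono: "{s\<in>carrier R. s \<otimes> a [^] k = \<zero>} \<subseteq> {s\<in>carrier R. s \<otimes> a [^] (max m n) = \<zero>}"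
    if "k \<le> max m n" for k
    using annihilator_nat_pow_mono[OF a _ _ that] by blast
  have "A \<subseteq> PIdl x <+>\<^bsub>R\<^esub> {s\<in>carrier R. s \<otimes> a [^] (max m n) = \<zero>}"
    using n mono[of n] unfolding subset_iff mem_cgenideal_plus by fastforce
  moreover have "y \<in> PIdl x <+>\<^bsub>R\<^esub> {s\<in>carrier R. s \<otimes> a [^] (max m n) = \<zero>}"
    using y mono[of m] unfolding mem_cgenideal_plus by fastforce
  ultimately show ?case by blast
qed

text \<open>Induction with the product lemma, since (Ra + T)(R a^(m+1) + T) is contained in R
  a^(m+2) + T.\<close>

lemma (in cring) all_homs_homotheties_nat_pow:
  assumes a: "a \<in> carrier R" and T: "ideal T R"
    and "all_homs_homotheties R (PIdl a <+>\<^bsub>R\<^esub> T)"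
  shows "all_homs_homotheties R (PIdl (a [^] Suc m) <+>\<^bsub>R\<^esub> T)"
proof (induction m)
  case 0
  have "a [^] Suc 0 = a" using a by simp
  then show ?case using assms(3) by metis
next
  case (Suc m)
  interpret T: ideal T R by (rule T)
  show ?case
  proof (rule all_homs_homotheties_product[OF assms(3) Suc])
    have pow: "a [^] Suc (Suc m) \<in> carrier R" using a by simp
    show "ideal (PIdl (a [^] Suc (Suc m)) <+>\<^bsub>R\<^esub> T) R"
      by (rule cgenideal_plus_ideal(1)[OF T pow])
    fix u v assume uv: "u \<in> PIdl a <+>\<^bsub>R\<^esub> T" "v \<in> PIdl (a [^] Suc m) <+>\<^bsub>R\<^esub> T"
    from uv(1) obtain r s where u: "r \<in> carrier R" "s \<in> T" "u = r \<otimes> a \<oplus> s"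
      by (rule cgenideal_plusE)
    from uv(2) obtain r' s' where v: "r' \<in> carrier R" "s' \<in> T" "v = r' \<otimes> a [^] Suc m \<oplus> s'"
      by (rule cgenideal_plusE)
    define b where "b = a [^] Suc m"
    have b: "b \<in> carrier R" using a by (simp add: b_def)
    have pow_eq: "a [^] Suc (Suc m) = a \<otimes> b"
      using m_comm[OF b a] by (simp add: b_def)
    have ss: "s \<in> carrier R" "s' \<in> carrier R" using T.Icarr u(2) v(2) by auto
    have "u \<otimes> v = (r \<otimes> r') \<otimes> (a \<otimes> b) \<oplus> ((r \<otimes> a \<oplus> s) \<otimes> s' \<oplus> (r' \<otimes> b) \<otimes> s)"
      unfolding u(3) v(3) b_def[symmetric] using a b ss u(1) v(1) by algebra
    moreover have "(r \<otimes> a \<oplus> s) \<otimes> s' \<oplus> (r' \<otimes> b) \<otimes> s \<in> T"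
      by (intro T.a_closed T.I_l_closed u(2) v(2)) (use a b ss u(1) v(1) in auto)
    ultimately show "u \<otimes> v \<in> PIdl (a [^] Suc (Suc m)) <+>\<^bsub>R\<^esub> T"
      unfolding pow_eq using cgenideal_plusI m_closed[OF u(1) v(1)] by simp
  qed
qed

text \<open>With b = a^n and d = a^(n+1), the assignment r d + s \<mapsto> r b is a homomorphism on
  Rd + ann(b). It is therefore multiplication by some \<open>c\<close>, and evaluating at
  \<open>d\<close> gives c d = b.\<close>

lemma (in cring) strongly_regular_power:
  assumes a: "a \<in> carrier R"
    and H: "all_homs_homotheties R (PIdl a <+>\<^bsub>R\<^esub> {s\<in>carrier R. s \<otimes> a [^] (n::nat) = \<zero>})"
  shows "\<exists>c\<in>carrier R. c \<otimes> a [^] Suc n = a [^] n"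
proof -
  define b d where "b = a [^] n" and "d = a [^] Suc n"
  let ?K = "PIdl d <+>\<^bsub>R\<^esub> {s\<in>carrier R. s \<otimes> b = \<zero>}"
  have bd: "b \<in> carrier R" "d \<in> carrier R" using a by (auto simp: b_def d_def)
  note K = all_homs_homothetiesD[OF
      all_homs_homotheties_nat_pow[OF a annihilator_ideal[OF bd(1)] H[folded b_def], of n, folded d_def]]
  have KE: "\<exists>r s. r \<in> carrier R \<and> s \<in> carrier R \<and> s \<otimes> b = \<zero> \<and> x = r \<otimes> d \<oplus> s" if "x \<in> ?K" for x
    using that by (rule cgenideal_plusE) blast
  \<comment> \<open>This is what makes the homomorphism well defined. If r d b = 0, then r b kills
    both Rd and ann(b), hence all of \<open>?K\<close>, and injectivity gives r b = 0.\<close>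
  have zero: "r \<otimes> b = \<zero>" if r: "r \<in> carrier R" "r \<otimes> d \<otimes> b = \<zero>" for r
  proof (rule K(2))
    fix x assume "x \<in> ?K"
    then obtain r' s where x: "r' \<in> carrier R" "s \<in> carrier R" "s \<otimes> b = \<zero>" "x = r' \<otimes> d \<oplus> s"
      using KE by metis
    have "r \<otimes> b \<otimes> x = r' \<otimes> (r \<otimes> d \<otimes> b) \<oplus> r \<otimes> (s \<otimes> b)"
      unfolding x(4) using x(1,2) r(1) bd by algebra
    then show "r \<otimes> b \<otimes> x = \<zero>" using x r by simp
  qed (use r bd in simp)
  define f where "f x = (THE y. \<exists>r s. r \<in> carrier R \<and> s \<in> carrier R \<and> s \<otimes> b = \<zero> \<and>
    x = r \<otimes> d \<oplus> s \<and> y = r \<otimes> b)" for x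
  have f: "f (r \<otimes> d \<oplus> s) = r \<otimes> b" if rs: "r \<in> carrier R" "s \<in> carrier R" "s \<otimes> b = \<zero>" for r s
    unfolding f_def
  proof (rule the_equality)
    fix y assume "\<exists>r' s'. r' \<in> carrier R \<and> s' \<in> carrier R \<and> s' \<otimes> b = \<zero> \<and>
      r \<otimes> d \<oplus> s = r' \<otimes> d \<oplus> s' \<and> y = r' \<otimes> b"
    then obtain r' s' where r': "r' \<in> carrier R" "s' \<in> carrier R" "s' \<otimes> b = \<zero>"
      "r \<otimes> d \<oplus> s = r' \<otimes> d \<oplus> s'" "y = r' \<otimes> b" by blast
    \<comment> \<open>Multiplying two representations of the same element by \<open>b\<close>
      removes \<open>s\<close> and \<open>s'\<close>, so that \<open>zero\<close> applies to r' -
      r.\<close>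
    have "(r \<otimes> d \<oplus> s) \<otimes> b = (r' \<otimes> d \<oplus> s') \<otimes> b" using r' by simp
    then have *: "r \<otimes> d \<otimes> b = r' \<otimes> d \<otimes> b" using rs r'(1-3) bd by (simp add: l_distr)
    have "(r' \<ominus> r) \<otimes> d \<otimes> b = r' \<otimes> d \<otimes> b \<ominus> r \<otimes> d \<otimes> b"
      using rs(1) r'(1) bd by algebra
    also have "\<dots> = \<zero>" using * rs(1) r'(1) bd by (simp add: a_minus_def r_neg)
    finally have "(r' \<ominus> r) \<otimes> b = \<zero>" using zero[of "r' \<ominus> r"] rs r' by simp
    moreover have "(r' \<ominus> r) \<otimes> b = r' \<otimes> b \<ominus> r \<otimes> b" using rs(1) r'(1) bd by algebra
    ultimately show "y = r \<otimes> b" using r'(1,5) rs(1) bd by simp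
  qed (intro exI[of _ r] exI[of _ s] conjI refl rs)
  have "\<exists>c\<in>carrier R. \<forall>x\<in>?K. f x = c \<otimes> x"
  proof (rule K(4))
    show "f x \<in> carrier R" if "x \<in> ?K" for x using KE[OF that] f bd by auto
    show "f (x \<oplus> y) = f x \<oplus> f y" if xy: "x \<in> ?K" "y \<in> ?K" for x y
    proof -
      obtain r s where x: "r \<in> carrier R" "s \<in> carrier R" "s \<otimes> b = \<zero>" "x = r \<otimes> d \<oplus> s"
        using KE[OF xy(1)] by metis
      obtain r' s' where y: "r' \<in> carrier R" "s' \<in> carrier R" "s' \<otimes> b = \<zero>" "y = r' \<otimes> d \<oplus> s'"
        using KE[OF xy(2)] by metis
      have "x \<oplus> y = (r \<oplus> r') \<otimes> d \<oplus> (s \<oplus> s')"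
        unfolding x(4) y(4) using x(1,2) y(1,2) bd by algebra
      then show ?thesis
        using f[of "r \<oplus> r'" "s \<oplus> s'"] f[of r s] f[of r' s'] x y bd by (simp add: l_distr)
    qed
    show "f (t \<otimes> x) = t \<otimes> f x" if t: "t \<in> carrier R" "x \<in> ?K" for t x
    proof -
      obtain r s where x: "r \<in> carrier R" "s \<in> carrier R" "s \<otimes> b = \<zero>" "x = r \<otimes> d \<oplus> s"
        using KE[OF t(2)] by metis
      have "t \<otimes> x = (t \<otimes> r) \<otimes> d \<oplus> t \<otimes> s"
        unfolding x(4) using x(1,2) t(1) bd by algebra
      then show ?thesis using f[of "t \<otimes> r" "t \<otimes> s"] f[of r s] x t bd by (simp add: m_assoc)
    qed
  qed
  then obtain c where c: "c \<in> carrier R" "\<forall>x\<in>?K. f x = c \<otimes> x" by blast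
  have "d \<in> ?K"
    by (rule cgenideal_plus_ideal(3)[OF annihilator_ideal[OF bd(1)] bd(2)])
  then have "f d = c \<otimes> d" using c(2) by blast
  moreover have "f d = b" using f[of \<one> \<zero>] bd by simp
  ultimately show ?thesis using c(1) unfolding b_def d_def by metis
qed

text \<open>Equivalently, R a^n = R a^(n+1) for some n: the powers of every principal ideal become
  stationary.\<close>

definition strongly_pi_regular :: "('a, 'm) ring_scheme \<Rightarrow> bool" where
  "strongly_pi_regular R \<longleftrightarrow> (\<forall>a\<in>carrier R. \<exists>n::nat. \<exists>c\<in>carrier R.
     c \<otimes>\<^bsub>R\<^esub> a [^]\<^bsub>R\<^esub> Suc n = a [^]\<^bsub>R\<^esub> n)"

lemma (in cring) w_dim_0_imp_strongly_pi_regular: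
  assumes "w_krull_dim R \<le> 0"
  shows "strongly_pi_regular R"
  unfolding strongly_pi_regular_def
proof
  fix a assume a: "a \<in> carrier R"
  let ?T = "{s\<in>carrier R. \<exists>n::nat. s \<otimes> a [^] n = \<zero>}"
  let ?Q = "PIdl a <+>\<^bsub>R\<^esub> ?T"
  note Q = cgenideal_plus_ideal[OF nat_pow_torsion_ideal[OF a] a]
  \<comment> \<open>Otherwise \<open>?Q\<close> lies in a maximal \<open>w\<close>-ideal
    \<open>M\<close> that is a minimal prime. As \<open>a\<close> is in \<open>M\<close>, some s
    outside \<open>M\<close> kills a power of \<open>a\<close>; but then s is in \<open>?T\<close>,
    hence in \<open>M\<close>.\<close>
  have "\<exists>J. GV_ideal R J \<and> J \<subseteq> ?Q"
  proof (rule ccontr)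
    assume "\<not> (\<exists>J. GV_ideal R J \<and> J \<subseteq> ?Q)"
    then obtain M where M: "maximal_w_ideal R M" "primeideal M R" "?Q \<subseteq> M"
      using contained_in_prime_maximal_w_ideal[OF Q(1)] by blast
    have "prime_height R M \<le> w_krull_dim R"
      unfolding w_krull_dim_def using M(1) by (intro Sup_upper) blast
    then have "prime_height R M \<le> 0" using assms by (rule order_trans)
    then have "\<And>P. primeideal P R \<Longrightarrow> \<not> P \<subset> M"
      using height_nonpos_imp_minimal M(2) by blast
    then obtain s and n :: nat where "s \<in> carrier R" "s \<notin> M" "s \<otimes> a [^] n = \<zero>"
      using minimal_prime_nilpotent[OF M(2)] M(3) Q(3) by blast
    then show False using Q(2) M(3) by blast
  qed
  then obtain J where J: "GV_ideal R J" "J \<subseteq> ?Q" by blast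
  from J(1) obtain A where A: "finite A" "A \<subseteq> carrier R" "J = Idl A" "all_homs_homotheties R J"
    by (rule GV_idealE)
  then have "A \<subseteq> ?Q" using J(2) genideal_self by blast
  \<comment> \<open>It suffices to place the finitely many generators of \<open>J\<close> at one
    stage n; the ideal at that stage then contains \<open>J\<close>.\<close>
  then obtain n :: nat where n: "A \<subseteq> PIdl a <+>\<^bsub>R\<^esub> {s\<in>carrier R. s \<otimes> a [^] n = \<zero>}"
    using finite_subset_nat_pow_torsion[OF a A(1)] by blast
  have "ideal (PIdl a <+>\<^bsub>R\<^esub> {s\<in>carrier R. s \<otimes> a [^] n = \<zero>}) R"
    by (rule cgenideal_plus_ideal(1)[OF annihilator_ideal a]) (use a in simp)
  then have "all_homs_homotheties R (PIdl a <+>\<^bsub>R\<^esub> {s\<in>carrier R. s \<otimes> a [^] n = \<zero>})"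
    using all_homs_homotheties_superset[OF A(4)] genideal_minimal n A(3) by blast
  then show "\<exists>n::nat. \<exists>c\<in>carrier R. c \<otimes> a [^] Suc n = a [^] n"
    using strongly_regular_power[OF a] by blast
qed

section \<open>Consequences of strong \<pi>-regularity: incomparable primes and trivial
  GV-ideals\<close>

text \<open>The factor 1 - ca lies outside every prime containing \<open>a\<close>, so this form
  shows that \<open>a\<close> is nilpotent in the localization at such a prime.\<close>

lemma (in cring) strongly_pi_regularE:
  assumes "strongly_pi_regular R" "a \<in> carrier R"
  obtains c and n :: nat where "c \<in> carrier R" "(\<one> \<ominus> c \<otimes> a) \<otimes> a [^] n = \<zero>"
proof -
  obtain c and n :: nat where c: "c \<in> carrier R" "c \<otimes> a [^] Suc n = a [^] n"
    using assms by (auto simp: strongly_pi_regular_def)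
  define b where "b = a [^] n"
  have b: "b \<in> carrier R" "c \<otimes> (b \<otimes> a) = b" using c assms(2) by (auto simp: b_def)
  have "(\<one> \<ominus> c \<otimes> a) \<otimes> b = b \<ominus> c \<otimes> (b \<otimes> a)" using b(1) c(1) assms(2) by algebra
  also have "\<dots> = \<zero>" using b by (simp add: a_minus_def r_neg)
  finally show thesis using that c(1) by (simp add: b_def)
qed

lemma (in cring) one_minus_notin_prime:
  assumes "primeideal P R" "a \<in> P" "c \<in> carrier R"
  shows "\<one> \<ominus> c \<otimes> a \<notin> P"
proof
  interpret P: primeideal P R by fact
  assume *: "\<one> \<ominus> c \<otimes> a \<in> P"
  have a: "a \<in> carrier R" using assms P.a_Hcarr by auto
  have "(\<one> \<ominus> c \<otimes> a) \<oplus> c \<otimes> a \<in> P" using * assms P.I_l_closed by (intro P.a_closed) auto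
  moreover have "(\<one> \<ominus> c \<otimes> a) \<oplus> c \<otimes> a = \<one>" using a assms(3) by algebra
  ultimately show False using P.one_imp_carrier P.I_notcarr by simp
qed

lemma (in primeideal) nat_pow_mem_imp:
  assumes "a \<in> carrier R" "a [^] (n::nat) \<in> I"
  shows "a \<in> I"
  using assms(2)
proof (induction n)
  case 0
  then show ?case using one_imp_carrier I_notcarr by simp
next
  case (Suc n)
  then show ?case using I_prime[of "a [^] n" a] assms(1) by auto
qed

text \<open>If a is in \<open>Q\<close> but not in \<open>P\<close>, the relation (1 - ca) a^n = 0
  forces 1 - ca into \<open>P\<close>, hence into \<open>Q\<close>, where it cannot be together with
  a.\<close>

lemma (in cring) strongly_pi_regular_primes_incomparable:
  assumes "strongly_pi_regular R" "primeideal P R" "primeideal Q R"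
  shows "\<not> P \<subset> Q"
proof
  interpret P: primeideal P R by fact
  interpret Q: primeideal Q R by fact
  assume "P \<subset> Q"
  then obtain a where a: "a \<in> Q" "a \<notin> P" by blast
  then have ac: "a \<in> carrier R" using Q.a_Hcarr by auto
  obtain c and n :: nat where c: "c \<in> carrier R" "(\<one> \<ominus> c \<otimes> a) \<otimes> a [^] n = \<zero>"
    using strongly_pi_regularE[OF assms(1) ac] .
  then have "(\<one> \<ominus> c \<otimes> a) \<otimes> a [^] n \<in> P" using P.zero_closed by simp
  then have "\<one> \<ominus> c \<otimes> a \<in> P \<or> a [^] n \<in> P" using P.I_prime ac c(1) by simp
  then show False
    using P.nat_pow_mem_imp[OF ac] a one_minus_notin_prime[OF assms(3) a(1) c(1)] \<open>P \<subset> Q\<close> by blast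
qed

text \<open>
  The condition on \<open>y\<close> says that its image in the localization at \<open>P\<close> is nonzero; it is the
  invariant that survives adding one more element to \<open>A\<close>.
\<close>
lemma (in cring) strongly_pi_regular_common_annihilator:
  assumes reg: "strongly_pi_regular R" and P: "primeideal P R" and "finite A" "A \<subseteq> P"
  shows "\<exists>y\<in>carrier R. (\<forall>t\<in>carrier R - P. t \<otimes> y \<noteq> \<zero>) \<and> (\<forall>a\<in>A. y \<otimes> a = \<zero>)"
  using assms(3,4)
proof (induction A)
  interpret P: primeideal P R by fact
  case empty
  have "t \<otimes> \<one> \<noteq> \<zero>" if "t \<in> carrier R - P" for t using that P.zero_closed by auto
  then show ?case by (intro bexI[of _ \<one>]) auto
next
  interpret P: primeideal P R by fact
  case (insert a A)
  then obtain y where y: "y \<in> carrier R" "\<forall>t\<in>carrier R - P. t \<otimes> y \<noteq> \<zero>" "\<forall>a\<in>A. y \<otimes> a = \<zero>"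
    by auto
  have aP: "a \<in> P" and a: "a \<in> carrier R" using insert.prems P.a_Hcarr by auto
  obtain c and n :: nat where c: "c \<in> carrier R" "(\<one> \<ominus> c \<otimes> a) \<otimes> a [^] n = \<zero>"
    using strongly_pi_regularE[OF reg a] .
  \<comment> \<open>\<open>Z k\<close> says that y a^k vanishes in the localization at
    \<open>P\<close>. This fails for k = 0 and holds for k = n, so it starts to hold at some
    \<open>Suc k\<close>, and y a^k is the new local witness.\<close>
  define Z where "Z k \<longleftrightarrow> (\<exists>t\<in>carrier R - P. t \<otimes> (y \<otimes> a [^] k) = \<zero>)" for k :: nat
  have "Z n"
  proof -
    have "(\<one> \<ominus> c \<otimes> a) \<otimes> (y \<otimes> a [^] n) = y \<otimes> ((\<one> \<ominus> c \<otimes> a) \<otimes> a [^] n)"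
      using a c(1) y(1) by (simp add: m_lcomm)
    then show ?thesis
      using one_minus_notin_prime[OF P aP c(1)] c a y(1) unfolding Z_def
      by (intro bexI[of _ "\<one> \<ominus> c \<otimes> a"]) auto
  qed
  moreover have "\<not> Z 0" using y by (auto simp: Z_def)
  ultimately obtain k where k: "\<not> Z k" "Z (Suc k)"
    using ex_least_nat_less[of Z n] by blast
  then obtain t where t: "t \<in> carrier R - P" "t \<otimes> (y \<otimes> a [^] Suc k) = \<zero>" by (auto simp: Z_def)
  \<comment> \<open>The factor \<open>t\<close> turns the local relation y a^(k+1) = 0 into one in
    R; being outside \<open>P\<close>, it does not make the witness vanish locally.\<close>
  define z where "z = t \<otimes> (y \<otimes> a [^] k)"
  have z: "z \<in> carrier R" using t y a by (simp add: z_def)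
  have "u \<otimes> z \<noteq> \<zero>" if u: "u \<in> carrier R - P" for u
  proof
    assume "u \<otimes> z = \<zero>"
    then have "(u \<otimes> t) \<otimes> (y \<otimes> a [^] k) = \<zero>" using u t y a by (simp add: z_def m_assoc)
    moreover have "u \<otimes> t \<in> carrier R - P" using u t P.I_prime by auto
    ultimately show False using k(1) by (auto simp: Z_def)
  qed
  moreover have "z \<otimes> a = \<zero>" using t y a by (simp add: z_def m_assoc)
  moreover have "z \<otimes> b = \<zero>" if "b \<in> A" for b
  proof -
    have b: "b \<in> carrier R" using that insert.prems P.a_Hcarr by auto
    have "z \<otimes> b = t \<otimes> a [^] k \<otimes> (y \<otimes> b)" using t y a b by (simp add: z_def m_ac)
    then show ?thesis using y(3) that t a by simp
  qed
  ultimately show ?case using z by blast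
qed

text \<open>A proper \<open>J\<close> lies in a prime, so its generators have a common annihilator y
  that is nonzero there. But y kills \<open>J\<close>, and injectivity of the natural map gives y =
  0.\<close>

lemma (in cring) strongly_pi_regular_GV_ideal:
  assumes "strongly_pi_regular R" "GV_ideal R J"
  shows "J = carrier R"
proof (rule ccontr)
  assume "J \<noteq> carrier R"
  from assms(2) obtain A where A: "finite A" "A \<subseteq> carrier R" "J = Idl A" "all_homs_homotheties R J"
    by (rule GV_idealE)
  note J = all_homs_homothetiesD[OF A(4)]
  have "\<one> \<notin> J" using ideal.one_imp_carrier[OF J(1)] \<open>J \<noteq> carrier R\<close> by blast
  then obtain P where P: "primeideal P R" "J \<subseteq> P" using exists_prime_ideal[OF J(1)] by blast
  interpret P: primeideal P R by fact
  have "A \<subseteq> P" using P(2) A(2,3) genideal_self by blast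
  then obtain y where y: "y \<in> carrier R" "\<forall>t\<in>carrier R - P. t \<otimes> y \<noteq> \<zero>" "\<forall>a\<in>A. y \<otimes> a = \<zero>"
    using strongly_pi_regular_common_annihilator[OF assms(1) P(1) A(1)] by blast
  have "J \<subseteq> {s\<in>carrier R. s \<otimes> y = \<zero>}"
    unfolding A(3)
    by (rule genideal_minimal[OF annihilator_ideal[OF y(1)]])
      (use y A(2) in \<open>auto simp: subset_iff m_comm\<close>)
  then have "y = \<zero>" using J(2)[OF y(1)] y(1) by (auto simp: subset_iff m_comm)
  moreover have "\<one> \<in> carrier R - P" using P.one_imp_carrier P.I_notcarr by auto
  ultimately show False using y(2) by auto
qed

lemma (in cring) strongly_pi_regular_DW:
  assumes "strongly_pi_regular R"
  shows "DW_ring R"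
  unfolding DW_ring_def w_ideal_def
proof (intro allI impI conjI)
  fix I assume I: "ideal I R"
  have "w_closure R I = {x\<in>carrier R. \<forall>a\<in>carrier R. a \<otimes> x \<in> I}"
    using strongly_pi_regular_GV_ideal[OF assms] GV_ideal_carrier
    unfolding w_closure_def by blast
  also have "\<dots> = I"
  proof (intro equalityI subsetI)
    fix x assume "x \<in> {x\<in>carrier R. \<forall>a\<in>carrier R. a \<otimes> x \<in> I}"
    then have "x \<in> carrier R" "\<one> \<otimes> x \<in> I" by blast+
    then show "x \<in> I" by simp
  qed (use ideal.I_l_closed[OF I] ideal.Icarr[OF I] in blast)
  finally show "w_closure R I = I" .
qed

lemma (in cring) strongly_pi_regular_krull_dim:
  assumes "strongly_pi_regular R" "\<one> \<noteq> \<zero>"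
  shows "krull_dim R = 0"
proof (rule antisym)
  show "krull_dim R \<le> 0"
    unfolding krull_dim_def
  proof (rule Sup_least)
    fix x assume "x \<in> {ereal (real n) | n. \<exists>P. prime_chain R n P}"
    then obtain n P where x: "x = ereal (real n)" and P: "prime_chain R n P" by blast
    have "n = 0"
    proof (rule ccontr)
      assume "n \<noteq> 0"
      then have "primeideal (P 0) R" "primeideal (P (Suc 0)) R" "P 0 \<subset> P (Suc 0)"
        using P by (auto simp: prime_chain_def)
      then show False using strongly_pi_regular_primes_incomparable[OF assms(1)] by blast
    qed
    then show "x \<le> 0" using x by simp
  qed
  \<comment> \<open>A nonzero ring has a prime; without one the dimension would be the supremum of
    the empty set, \<open>- \<infinity>\<close>.\<close>
  obtain P where "primeideal P R" using exists_prime_ideal[OF zeroideal] assms(2) by blast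
  then have "prime_chain R 0 (\<lambda>_. P)" by (simp add: prime_chain_def)
  then have "ereal (real 0) \<le> krull_dim R"
    unfolding krull_dim_def by (intro Sup_upper) blast
  then show "0 \<le> krull_dim R" by (simp add: zero_ereal_def)
qed

theorem theorem2p7:
  fixes R :: "('a, 'm) ring_scheme"
  assumes "cring R"
    and "w_krull_dim R = 0"
  shows "krull_dim R = 0 \<and> DW_ring R"
proof -
  interpret cring R by fact
  \<comment> \<open>The value 0, as opposed to \<open>- \<infinity>\<close>, provides a maximal
    \<open>w\<close>-ideal. Being a proper ideal, it shows that R is not the zero ring.\<close>
  have "\<exists>M. maximal_w_ideal R M"
  proof (rule ccontr)
    assume "\<nexists>M. maximal_w_ideal R M"
    then have "w_krull_dim R = - \<infinity>" by (simp add: w_krull_dim_def bot_ereal_def)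
    then show False using assms(2) by simp
  qed
  then obtain M where "ideal M R" "M \<noteq> carrier R"
    by (auto simp: maximal_w_ideal_def w_ideal_def)
  then have "\<one>\<^bsub>R\<^esub> \<noteq> \<zero>\<^bsub>R\<^esub>"
    using ideal.one_imp_carrier additive_subgroup.zero_closed ideal.axioms(1) by metis
  then show ?thesis
    using w_dim_0_imp_strongly_pi_regular assms(2)
      strongly_pi_regular_krull_dim strongly_pi_regular_DW by simp
qed

end
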